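(* Let $\mathbf{n}\in\mathbb{R}^3$ be a unit vector, let $\theta\in(-\pi,\pi)$, and let $\mathbf{Q}=\tan(\theta/2)\,\mathbf{n}$ be the Rodrigues' vector of the rotation of angle $\theta$ about the axis through the origin oriented by $\mathbf{n}$. Then for every $\mathbf{x}\in\mathbb{R}^3$ the vector $(\mathbf{1}+\mathbf{Q}\times)\mathbf{x}=\mathbf{x}+\mathbf{Q}\times\mathbf{x}$ is the position vector of the intersection point of the tangent at $\mathbf{x}$ to the arc described by $\mathbf{x}$ as it rotates about the axis and the bisector of the rotation angle at $\mathbf{x}$; that is, $T(\mathbf{x})\cap B(\mathbf{x})=\{\mathbf{x}+\mathbf{Q}\times\mathbf{x}\}$, where $T(\mathbf{x})$ denotes this tangent and $B(\mathbf{x})$ this bisector.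
   Context: For a unit vector $\mathbf{n}\in\mathbb{R}^3$ and $\varphi\in\mathbb{R}$, $\mathbf{R}(\mathbf{n},\varphi)$ denotes the (active, right-handed) rotation of $\mathbb{R}^3$ of angle $\varphi$ about the axis $\mathbb{R}\mathbf{n}$ through the origin, i.e. $\mathbf{R}(\mathbf{n},\varphi)\mathbf{x}=\cos\varphi\,\mathbf{x}+\sin\varphi\,(\mathbf{n}\times\mathbf{x})+(1-\cos\varphi)(\mathbf{n}\cdot\mathbf{x})\mathbf{n}$. The Rodrigues' vector of the rotation $\mathbf{R}(\mathbf{n},\theta)$, with $\theta\in(-\pi,\pi)$, is $\mathbf{Q}=\tan(\theta/2)\,\mathbf{n}$; $\mathbf{1}$ is the identity and $(\mathbf{Q}\times)$ is the linear operator $\mathbf{x}\mapsto\mathbf{Q}\times\mathbf{x}$. The arc described by $\mathbf{x}$ under the rotation is $\{\mathbf{R}(\mathbf{n},\varphi)\mathbf{x}:\varphi\text{ between }0\text{ and }\theta\}$; it lies in the plane through $\mathbf{x}$ perpendicular to $\mathbf{n}$ and has center $\mathbf{c}=(\mathbf{n}\cdot\mathbf{x})\mathbf{n}$. The tangent at $\mathbf{x}$ is $T(\mathbf{x})=\{\mathbf{x}+t\,\mathbf{v}:t\in\mathbb{R}\}$, where $\mathbf{v}=\mathbf{n}\times\mathbf{x}$ is the derivative at $\varphi=0$ of $\varphi\mapsto\mathbf{R}(\mathbf{n},\varphi)\mathbf{x}$. The bisector of the rotation angle at $\mathbf{x}$ is the ray in the plane of the arc from the center through the midpoint of the arc: $B(\mathbf{x})=\{\mathbf{c}+s\,\mathbf{R}(\mathbf{n},\theta/2)(\mathbf{x}-\mathbf{c}):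 s\ge 0\}$. (If $\mathbf{x}$ lies on the axis, both sets degenerate to the single point $\mathbf{x}$.) *)

theory Defs
  imports "HOL-Analysis.Analysis"
begin

definition rotation3 :: "real ^ 3 \<Rightarrow> real \<Rightarrow> real ^ 3 \<Rightarrow> real ^ 3" where
  "rotation3 n \<phi> x = cos \<phi> *\<^sub>R x + sin \<phi> *\<^sub>R cross3 n x + ((1 - cos \<phi>) * (n \<bullet> x)) *\<^sub>R n"

definition rodrigues_vector :: "real ^ 3 \<Rightarrow> real \<Rightarrow> real ^ 3" where
  "rodrigues_vector n \<theta> = tan (\<theta> / 2) *\<^sub>R n"

definition arc_center :: "real ^ 3 \<Rightarrow> real ^ 3 \<Rightarrow> real ^ 3" where
  "arc_center n x = (n \<bullet> x) *\<^sub>R n"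

(* The direction is the velocity of the rotating point at its starting position; it does not
   depend on the rotation angle, so the tangent is also defined for angle 0. *)
definition arc_tangent :: "real ^ 3 \<Rightarrow> real ^ 3 \<Rightarrow> (real ^ 3) set" where
  "arc_tangent n x =
     range (\<lambda>t. x + t *\<^sub>R vector_derivative (\<lambda>\<phi>. rotation3 n \<phi> x) (at 0))"

definition angle_bisector :: "real ^ 3 \<Rightarrow> real \<Rightarrow> real ^ 3 \<Rightarrow> (real ^ 3) set" where
  "angle_bisector n \<theta> x =
     {arc_center n x + s *\<^sub>R rotation3 n (\<theta> / 2) (x - arc_center n x) | s. 0 \<le> s}"

lemma vector_derivative_rotation3:
  "vector_derivative (\<lambda>\<phi>. rotation3 n \<phi> x) (at 0) = cross3 n x"
proof (rule vector_derivative_at)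
  show "((\<lambda>\<phi>. rotation3 n \<phi> x) has_vector_derivative cross3 n x) (at 0)"
    unfolding rotation3_def
    by (auto intro!: derivative_eq_intros simp: has_real_derivative_iff_has_vector_derivative [symmetric])
qed

lemma arc_tangent_eq: "arc_tangent n x = range (\<lambda>t. x + t *\<^sub>R cross3 n x)"
  by (simp add: arc_tangent_def vector_derivative_rotation3)

(* The bisector is the ray from the center through the midpoint of the arc. *)
lemma rotation3_diff_arc_center:
  assumes "norm n = 1"
  shows "rotation3 n \<phi> (x - arc_center n x) = rotation3 n \<phi> x - arc_center n x"
proof -
  have "n \<bullet> n = 1"
    using assms by (simp add: norm_eq_1)
  moreover have "cross3 n (x - (n \<bullet> x) *\<^sub>R n) = cross3 n x"
    by (simp add: Cross3.right_diff_distrib cross_mult_right)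
  ultimately show ?thesis
    by (simp add: rotation3_def arc_center_def inner_diff_right scaleR_diff_right
        scaleR_diff_left left_diff_distrib)
qed

end

theory Submission
  imports Defs
begin

text \<open>
  Let \<open>u\<close> be the radius vector from the center \<open>c\<close> to \<open>x\<close> and \<open>w\<close> the velocity at \<open>x\<close>. These are
  orthogonal vectors of equal length, and a common point of the two sets satisfies
  \<open>u + t w = s (cos (\<theta>/2) u + sin (\<theta>/2) w)\<close>. Comparing coefficients gives
  \<open>s = 1 / cos (\<theta>/2)\<close> and \<open>t = tan (\<theta>/2)\<close>, unless \<open>u = w = 0\<close>.
\<close>

lemma inner_diff_arc_center:
  assumes "norm n = 1"
  shows "n \<bullet> (x - arc_center n x) = 0"
  using assms by (simp add: arc_center_def inner_diff_right norm_eq_1)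

lemma cross3_diff_arc_center: "cross3 n (x - arc_center n x) = cross3 n x"
  by (simp add: arc_center_def Cross3.right_diff_distrib cross_mult_right)

text \<open>Lagrange's identity for \<open>n\<close> and the radius vector: their inner product
  vanishes and \<open>n\<close> is a unit vector, so the cross product keeps the length.\<close>

lemma norm_cross3_arc_center:
  assumes "norm n = 1"
  shows "norm (cross3 n x) = norm (x - arc_center n x)"
proof -
  have "(norm (cross3 n (x - arc_center n x)))\<^sup>2 = (norm (x - arc_center n x))\<^sup>2"
    using norm_cross_dot[of n "x - arc_center n x"] assms
    by (simp add: inner_diff_arc_center)
  then show ?thesis
    by (simp add: cross3_diff_arc_center)
qed

text \<open>The radius vector is orthogonal to \<open>n\<close>, so the axial term of the rotation
  formula drops out.\<close>

lemma angle_bisector_eq: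
  assumes "norm n = 1"
  shows "angle_bisector n \<theta> x =
    {arc_center n x + s *\<^sub>R (cos (\<theta> / 2) *\<^sub>R (x - arc_center n x) + sin (\<theta> / 2) *\<^sub>R cross3 n x) | s. 0 \<le> s}"
  by (simp add: angle_bisector_def rotation3_def inner_diff_arc_center[OF assms]
      cross3_diff_arc_center)

text \<open>Pairing the equation with \<open>u\<close> and with \<open>w\<close> isolates one
  coefficient each.\<close>

lemma orthogonal_coeffs_unique:
  fixes u w :: "'a::real_inner"
  assumes "u \<bullet> w = 0" and "u \<noteq> 0" and "w \<noteq> 0"
    and "a *\<^sub>R u + b *\<^sub>R w = a' *\<^sub>R u + b' *\<^sub>R w"
  shows "a = a' \<and> b = b'"
proof -
  have "u \<bullet> (a *\<^sub>R u + b *\<^sub>R w) = u \<bullet> (a' *\<^sub>R u + b' *\<^sub>R w)"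
    and "w \<bullet> (a *\<^sub>R u + b *\<^sub>R w) = w \<bullet> (a' *\<^sub>R u + b' *\<^sub>R w)"
    using assms(4) by simp_all
  then show ?thesis
    using assms(1-3) by (simp add: inner_add_right inner_commute[of w u])
qed

theorem mainTheorem2:
  fixes n x :: "real ^ 3" and \<theta> :: real
  assumes "norm n = 1"
    and "- pi < \<theta>" and "\<theta> < pi"
  shows "arc_tangent n x \<inter> angle_bisector n \<theta> x = {x + cross3 (rodrigues_vector n \<theta>) x}"
proof -
  define c where "c = arc_center n x"
  define u where "u = x - c"
  define w where "w = cross3 n x"
  have x: "x = c + u"
    by (simp add: u_def)
  have norm_w: "norm w = norm u"
    unfolding u_def w_def c_def by (rule norm_cross3_arc_center[OF assms(1)])
  \<comment> \<open>The axial part of \<open>x\<close> does not affect the cross product, so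
    \<open>w\<close> is also \<open>n\<close> cross \<open>u\<close>.\<close>
  have orth: "u \<bullet> w = 0"
    unfolding u_def w_def c_def
    by (metis cross3_diff_arc_center dot_cross_self(2) inner_commute)
  \<comment> \<open>The half angle lies strictly between \<open>- pi / 2\<close> and
    \<open>pi / 2\<close>. Positivity permits the division and puts the point on the ray, where
    \<open>s\<close> must be nonnegative.\<close>
  have cos_pos: "cos (\<theta> / 2) > 0"
    using assms by (intro cos_gt_zero_pi) auto
  have tangent: "arc_tangent n x = range (\<lambda>t. c + u + t *\<^sub>R w)"
    using arc_tangent_eq[of n x] by (simp add: w_def flip: x)
  have bisector: "angle_bisector n \<theta> x =
      {c + s *\<^sub>R (cos (\<theta> / 2) *\<^sub>R u + sin (\<theta> / 2) *\<^sub>R w) | s. 0 \<le> s}"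
    unfolding angle_bisector_eq[OF assms(1)] u_def w_def c_def ..
  have point: "x + cross3 (rodrigues_vector n \<theta>) x = c + u + tan (\<theta> / 2) *\<^sub>R w"
    by (simp add: x[symmetric] w_def rodrigues_vector_def cross_mult_left)
  have "c + u + tan (\<theta> / 2) *\<^sub>R w
      = c + (1 / cos (\<theta> / 2)) *\<^sub>R (cos (\<theta> / 2) *\<^sub>R u + sin (\<theta> / 2) *\<^sub>R w)"
    using cos_pos by (simp add: tan_def scaleR_add_right)
  then have "c + u + tan (\<theta> / 2) *\<^sub>R w \<in> angle_bisector n \<theta> x"
    unfolding bisector using cos_pos by (intro CollectI exI[of _ "1 / cos (\<theta> / 2)"]) simp
  moreover have "y = c + u + tan (\<theta> / 2) *\<^sub>R w"
    if y: "y \<in> arc_tangent n x" "y \<in> angle_bisector n \<theta> x" for y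
  proof -
    obtain t s where t: "y = c + u + t *\<^sub>R w"
      and s: "y = c + s *\<^sub>R (cos (\<theta> / 2) *\<^sub>R u + sin (\<theta> / 2) *\<^sub>R w)"
      using y unfolding tangent bisector by blast
    show ?thesis
    \<comment> \<open>If \<open>x\<close> is on the axis, \<open>w\<close> vanishes with
      \<open>u\<close>, so \<open>t\<close> is undetermined but every \<open>t\<close> gives the
      same point.\<close>
    proof (cases "u = 0")
      case True
      then show ?thesis
        using t norm_w by simp
    next
      case False
      then have "w \<noteq> 0"
        using norm_w by auto
      have "1 *\<^sub>R u + t *\<^sub>R w = (s * cos (\<theta> / 2)) *\<^sub>R u + (s * sin (\<theta> / 2)) *\<^sub>R w"
        using t s by (simp add: scaleR_add_right add.assoc)
      from orthogonal_coeffs_unique[OF orth False \<open>w \<noteq> 0\<close> this]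
      have "1 = s * cos (\<theta> / 2)" and "t = s * sin (\<theta> / 2)"
        by auto
      then have "t = tan (\<theta> / 2)"
        using cos_pos by (simp add: tan_def field_simps)
      then show ?thesis
        using t by simp
    qed
  qed
  ultimately show ?thesis
    unfolding point tangent by blast
qed

end
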